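(* Let $X$ be a Banach space, and let $M,N$ be two closed subspaces of $X$. Then the following assertions are equivalent: (i) $M+N$ is closed in $X$; (ii) $(M+N)/N$ is closed in $X/N$; (iii) there exists a constant $K>0$ such that for every $x\in M+N$ there is a decomposition $x=m+n$ with $m\in M$ and $n\in N$ such that $\|m\|\leq K\cdot\|x\|$; (iv) the mapping $T:M\times N\to M+N$, $(m,n)\mapsto m+n$, is an open mapping.
   Context: $X$ is a Banach space (over the real or complex numbers) with norm $\|\cdot\|$, and "subspace" means linear subspace. $M+N=\{m+n: m\in M,\ n\in N\}$; the sum is not assumed to be direct, i.e. $M\cap N$ may be nonzero. $M+N$ carries the norm (and topology) inherited from $X$. $M\times N$ carries the norm $\|(m,n)\|=\|m\|+\|n\|$ (which induces the product topology). $X/N$ is the quotient Banach space with the quotient norm $\|x+N\|=\inf_{y\in N}\|x+y\|$, and $(M+N)/N$ is regarded as the linear subspace $\{x+N: x\in M+N\}$ of $X/N$. *)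

theory Defs
  imports "HOL-Analysis.Analysis" "HOL-Library.Set_Algebras"
begin

(* Class banach only provides real scalars. The locale adds a scalar multiplication over 'k
   extending the real one, for which the norm is homogeneous. Every real_normed_field is
   isometrically isomorphic to the reals or the complex numbers, so these are exactly the real and
   the complex Banach spaces; for 'k = real the parameter is forced to be scaleR. *)
locale banach_space_over = vector_space scale
  for scale :: "'k::real_normed_field \<Rightarrow> 'a::banach \<Rightarrow> 'a" +
  assumes scale_of_real: "scale (of_real r) x = r *\<^sub>R x"
    and norm_scale: "norm (scale c x) = norm c * norm x"

lemma (in banach_space_over) subspace_imp_real_subspace:
  "module.subspace scale S \<Longrightarrow> Real_Vector_Spaces.subspace S"
  by (metis real_vector.subspace_def scale_of_real subspace_def)

lemma banach_space_over_real: "banach_space_over (scaleR :: real \<Rightarrow> 'a::banach \<Rightarrow> 'a)"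
  by unfold_locales (auto simp: algebra_simps)

lemma banach_space_over_complex: "banach_space_over ((*) :: complex \<Rightarrow> complex \<Rightarrow> complex)"
  by unfold_locales (auto simp: algebra_simps norm_mult scaleR_conv_of_real)

(* The elements of X/N are the cosets x +o N, as subsets of X. *)
definition quotient_space :: "'a::real_normed_vector set \<Rightarrow> 'a set set"
  where "quotient_space N = range (\<lambda>x. x +o N)"

definition quotient_norm :: "'a::real_normed_vector set \<Rightarrow> real"
  where "quotient_norm C = (INF c\<in>C. norm c)"

(* The set of differences c - d is the coset C - D. The value off X/N is irrelevant; 0 is chosen
   because Metric_space requires symmetry and nonnegativity on the whole type. *)
definition quotient_dist :: "'a::real_normed_vector set \<Rightarrow> 'a set \<Rightarrow> 'a set \<Rightarrow> real"
  where "quotient_dist N C D =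
    (if C \<in> quotient_space N \<and> D \<in> quotient_space N
     then quotient_norm {c - d | c d. c \<in> C \<and> d \<in> D} else 0)"

definition quotient_topology :: "'a::real_normed_vector set \<Rightarrow> 'a set topology"
  where "quotient_topology N = Metric_space.mtopology (quotient_space N) (quotient_dist N)"

lemma quotient_norm_coset: "quotient_norm (x +o N) = (INF y\<in>N. norm (x + y))"
proof -
  have "x +o N = (+) x ` N" by (auto simp: elt_set_plus_def)
  then show ?thesis by (simp add: quotient_norm_def image_image)
qed

lemma quotient_dist_coset:
  assumes "subspace N"
  shows "quotient_dist N (x +o N) (y +o N) = quotient_norm ((x - y) +o N)"
proof -
  have "{c - d | c d. c \<in> x +o N \<and> d \<in> y +o N} = (x - y) +o N" (is "?L = ?R")
  proof
    show "?L \<subseteq> ?R"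
    proof
      fix z assume "z \<in> ?L"
      then obtain a b where "a \<in> N" "b \<in> N" "z = (x + a) - (y + b)"
        by (auto simp: elt_set_plus_def)
      then have "a - b \<in> N" "z = (x - y) + (a - b)"
        using assms by (auto simp: subspace_diff)
      then show "z \<in> ?R" by (auto simp: elt_set_plus_def)
    qed
    show "?R \<subseteq> ?L"
    proof
      fix z assume "z \<in> ?R"
      then obtain a where "a \<in> N" "z = (x + a) - (y + 0)"
        by (auto simp: elt_set_plus_def)
      moreover have "0 \<in> N" using assms by (rule subspace_0)
      ultimately show "z \<in> ?L" unfolding elt_set_plus_def by blast
    qed
  qed
  then show ?thesis by (simp add: quotient_dist_def quotient_space_def)
qed

lemma quotient_norm_infdist:
  assumes "subspace N" shows "quotient_norm (x +o N) = infdist x N"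
proof -
  have "(\<lambda>y. norm (x + y)) ` N = dist x ` N"
  proof (intro equalityI subsetI)
    fix r assume "r \<in> (\<lambda>y. norm (x + y)) ` N"
    then obtain y where "y \<in> N" "r = dist x (- y)" by (auto simp: dist_norm)
    then show "r \<in> dist x ` N" using assms by (auto simp: subspace_neg)
  next
    fix r assume "r \<in> dist x ` N"
    then obtain y where "y \<in> N" "r = norm (x + (- y))" by (auto simp: dist_norm)
    then show "r \<in> (\<lambda>y. norm (x + y)) ` N"
      using assms subspace_neg by blast
  qed
  moreover have "N \<noteq> {}" using subspace_0[OF assms] by auto
  ultimately show ?thesis by (simp add: quotient_norm_coset infdist_def)
qed

lemma Metric_space_quotient:
  assumes N: "subspace N" and cl: "closed N"
  shows "Metric_space (quotient_space N) (quotient_dist N)"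
proof -
  have ne: "N \<noteq> {}" using subspace_0[OF N] by auto
  have d: "quotient_dist N (x +o N) (y +o N) = infdist (x - y) N" for x y
    by (simp add: quotient_dist_coset quotient_norm_infdist N)
  have coset_eq: "x +o N = y +o N" if "x - y \<in> N" for x y
  proof -
    have "u +o N \<subseteq> v +o N" if "u - v \<in> N" for u v
    proof
      fix z assume "z \<in> u +o N"
      then obtain a where "a \<in> N" "z = v + ((u - v) + a)" by (auto simp: elt_set_plus_def)
      then show "z \<in> v +o N" using that N subspace_add unfolding elt_set_plus_def by blast
    qed
    moreover have "y - x \<in> N" using subspace_neg[OF N that] by simp
    ultimately show ?thesis using that by blast
  qed
  have sym: "infdist x N = infdist (- x) N" for x
  proof -
    have "infdist (- x) N \<le> infdist x N" for x
      unfolding infdist_notempty[OF ne, of x]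
    proof (rule cINF_greatest[OF ne])
      fix a assume "a \<in> N"
      then have "infdist (- x) N \<le> dist (- x) (- a)"
        using N by (intro infdist_le) (simp add: subspace_neg)
      then show "infdist (- x) N \<le> dist x a" by (simp add: dist_norm norm_minus_commute)
    qed
    from this[of x] this[of "- x"] show ?thesis by simp
  qed
  have tri: "infdist (x + y) N \<le> infdist x N + infdist y N" for x y
  proof (rule field_le_epsilon)
    fix e :: real assume "0 < e"
    then have "infdist x N < infdist x N + e/2" "infdist y N < infdist y N + e/2" by auto
    then obtain a b where ab: "a \<in> N" "dist x a < infdist x N + e/2"
        "b \<in> N" "dist y b < infdist y N + e/2"
      unfolding infdist_notempty[OF ne] using cINF_less_iff[OF ne bdd_below_image_dist] by metis
    have "infdist (x + y) N \<le> dist (x + y) (a + b)"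
      using ab N by (intro infdist_le) (simp add: subspace_add)
    also have "\<dots> \<le> dist x a + dist y b" by (rule dist_triangle_add)
    finally show "infdist (x + y) N \<le> infdist x N + infdist y N + e" using ab by simp
  qed
  have zero: "infdist x N = 0 \<longleftrightarrow> x \<in> N" for x
    using in_closed_iff_infdist_zero[OF cl ne] by simp
  show ?thesis
  proof
    fix C D
    show "0 \<le> quotient_dist N C D"
    proof (cases "C \<in> quotient_space N \<and> D \<in> quotient_space N")
      case True
      then show ?thesis by (auto simp: quotient_space_def d infdist_nonneg)
    qed (auto simp: quotient_dist_def)
    show "quotient_dist N C D = quotient_dist N D C"
    proof (cases "C \<in> quotient_space N \<and> D \<in> quotient_space N")
      case True
      then obtain x y where "C = x +o N" "D = y +o N" by (auto simp: quotient_space_def)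
      then show ?thesis using sym[of "x - y"] by (simp add: d)
    qed (auto simp: quotient_dist_def)
  next
    fix C D assume "C \<in> quotient_space N" "D \<in> quotient_space N"
    then obtain x y where CD: "C = x +o N" "D = y +o N" by (auto simp: quotient_space_def)
    have "x - y \<in> N" if "x +o N = y +o N"
    proof -
      have "x \<in> x +o N" using subspace_0[OF N] by (force simp: elt_set_plus_def)
      then have "x \<in> y +o N" by (simp only: that)
      then obtain a where "a \<in> N" "x = y + a" by (auto simp: elt_set_plus_def)
      then show ?thesis by simp
    qed
    then show "quotient_dist N C D = 0 \<longleftrightarrow> C = D" unfolding CD d zero using coset_eq by blast
  next
    fix C D E assume "C \<in> quotient_space N" "D \<in> quotient_space N" "E \<in> quotient_space N"
    then obtain x y z where CDE: "C = x +o N" "D = y +o N" "E = z +o N"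
      by (auto simp: quotient_space_def)
    show "quotient_dist N C E \<le> quotient_dist N C D + quotient_dist N D E"
      unfolding CDE d using tri[of "x - y" "y - z"] by simp
  qed
qed

end

theory Submission
  imports Defs
begin

text \<open>
  The four assertions do not mention scalars, and a subspace over \<open>'k\<close> is in particular a real
  subspace, so it is enough to treat closed real subspaces \<open>M\<close> and \<open>N\<close>.

  The heart is the equivalence of closedness of \<open>M + N\<close> with the bounded splitting
  \<open>x = m + n\<close>, \<open>norm m \<le> K * norm x\<close>. Both directions rest on one successive approximation argument,
  \<open>bounded_splitting_from_approximate\<close>: if in some subspace \<open>V \<supseteq> M + N\<close> every \<open>y\<close> can be
  approximated by a sum \<open>m + n\<close> with error at most half of \<open>norm y\<close> and with \<open>norm m \<le> K * norm y\<close>,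
  then every element of \<open>V\<close> splits exactly, at the price of doubling \<open>K\<close>. Only the
  \<open>M\<close>-components need to be controlled: their series converges absolutely, and then the series of
  the \<open>N\<close>-components converges because the sum of the two does.

  If \<open>M + N\<close> is closed, it is completely metrizable and is the union of the sets \<open>D k\<close> of sums
  whose \<open>M\<close>-component can be chosen of norm at most \<open>k\<close>. Baire's theorem makes the closure of some
  \<open>D k\<close> a neighbourhood of one of its points, and differences of elements of \<open>D k\<close>, rescaled, give
  the approximation with \<open>V = M + N\<close>. Conversely, a bounded splitting on \<open>M + N\<close> gives the
  approximation on \<open>V = closure (M + N)\<close>, so every point of the closure already is a sum.

  Openness of the addition map is, by translation and scaling, the bounded splitting near \<open>0\<close>. The
  equivalence with the quotient holds because \<open>M + N\<close> is a union of cosets of \<open>N\<close>, and the ball of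
  radius \<open>r\<close> in the quotient is the image of the ball of radius \<open>r\<close>.
\<close>

section \<open>Sums of subspaces\<close>

lemma subspace_set_plus:
  fixes M N :: "'a::real_vector set"
  assumes "subspace M" "subspace N"
  shows "subspace (M + N)"
proof -
  have "M + N = {x + y |x y. x \<in> M \<and> y \<in> N}"
    by (auto simp: set_plus_def)
  then show ?thesis
    using subspace_sums[OF assms] by simp
qed

text \<open>
  Applied with \<open>c = 1 / t\<close>, this moves a difference of two sums back to the scale of the vector that
  it approximates.
\<close>

lemma set_plus_diff_split:
  fixes M N :: "'a::real_vector set"
  assumes "subspace M" "subspace N"
    and "p = m + n" "m \<in> M" "n \<in> N" and "q = m' + n'" "m' \<in> M" "n' \<in> N"
  shows "c *\<^sub>R (q - p) = c *\<^sub>R (m' - m) + c *\<^sub>R (n' - n)"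
    and "c *\<^sub>R (m' - m) \<in> M" and "c *\<^sub>R (n' - n) \<in> N"
  using assms by (auto simp: algebra_simps subspace_diff subspace_scale)

lemma subspace_closure:
  fixes S :: "'a::real_normed_vector set"
  assumes S: "subspace S"
  shows "subspace (closure S)"
proof (rule subspaceI)
  show "0 \<in> closure S"
    using subspace_0[OF S] closure_subset by blast
next
  fix x y assume "x \<in> closure S" "y \<in> closure S"
  then obtain f g where "\<And>n. f n \<in> S" "f \<longlonglongrightarrow> x" "\<And>n. g n \<in> S" "g \<longlonglongrightarrow> y"
    unfolding closure_sequential by blast
  then have "\<And>n. f n + g n \<in> S" "(\<lambda>n. f n + g n) \<longlonglongrightarrow> x + y"
    using S by (auto simp: subspace_add intro: tendsto_add)
  then show "x + y \<in> closure S"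
    unfolding closure_sequential by (intro exI[of _ "\<lambda>n. f n + g n"]) simp
next
  fix c :: real and x assume "x \<in> closure S"
  then obtain f where "\<And>n. f n \<in> S" "f \<longlonglongrightarrow> x"
    unfolding closure_sequential by blast
  then have "\<And>n. c *\<^sub>R f n \<in> S" "(\<lambda>n. c *\<^sub>R f n) \<longlonglongrightarrow> c *\<^sub>R x"
    using S by (auto simp: subspace_scale intro: tendsto_scaleR)
  then show "c *\<^sub>R x \<in> closure S"
    unfolding closure_sequential by (intro exI[of _ "\<lambda>n. c *\<^sub>R f n"]) simp
qed

section \<open>Closedness and bounded splittings\<close>

text \<open>
  Replacing \<open>y\<close> by the error \<open>y - (m + n)\<close> halves the norm at each step, so the \<open>M\<close>-components are
  dominated by a geometric series with sum \<open>2 * K * norm x\<close>. The partial sums of the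
  \<open>N\<close>-components are then the difference of two convergent sequences, and closedness of \<open>M\<close>
  and \<open>N\<close> puts the two limits where they belong. The errors stay in \<open>V\<close> because \<open>V\<close>
  contains \<open>M + N\<close>.
\<close>

lemma bounded_splitting_from_approximate:
  fixes M N V :: "'a::banach set"
  assumes M: "closed M" "subspace M" and N: "closed N" "subspace N"
    and V: "subspace V" "M + N \<subseteq> V"
    and approx: "\<And>y. y \<in> V \<Longrightarrow>
      \<exists>m\<in>M. \<exists>n\<in>N. norm m \<le> K * norm y \<and> norm (y - (m + n)) \<le> norm y / 2"
    and K: "K \<ge> 0" and x: "x \<in> V"
  shows "\<exists>m\<in>M. \<exists>n\<in>N. x = m + n \<and> norm m \<le> 2 * K * norm x"
proof -
  have "\<forall>y\<in>V. \<exists>p. fst p \<in> M \<and> snd p \<in> N \<and> norm (fst p) \<le> K * norm y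
      \<and> norm (y - (fst p + snd p)) \<le> norm y / 2"
    using approx by fastforce
  then obtain h where h: "\<forall>y\<in>V. fst (h y) \<in> M \<and> snd (h y) \<in> N
      \<and> norm (fst (h y)) \<le> K * norm y \<and> norm (y - (fst (h y) + snd (h y))) \<le> norm y / 2"
    by (rule bchoice[THEN exE])
  define f g where "f y = fst (h y)" and "g y = snd (h y)" for y
  have fg: "\<And>y. y \<in> V \<Longrightarrow> f y \<in> M" "\<And>y. y \<in> V \<Longrightarrow> g y \<in> N"
    "\<And>y. y \<in> V \<Longrightarrow> norm (f y) \<le> K * norm y"
    "\<And>y. y \<in> V \<Longrightarrow> norm (y - (f y + g y)) \<le> norm y / 2"
    using h by (simp_all add: f_def g_def)
  define r where "r = rec_nat x (\<lambda>_ y. y - (f y + g y))"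
  have r0: "r 0 = x" and rS: "r (Suc k) = r k - (f (r k) + g (r k))" for k
    by (simp_all add: r_def)
  have rV: "r k \<in> V" for k
  proof (induction k)
    case (Suc k)
    then have "f (r k) + g (r k) \<in> V"
      using subsetD[OF V(2) set_plus_intro] fg(1,2) by simp
    then show ?case
      using Suc V(1) by (simp add: rS subspace_diff)
  qed (simp add: r0 x)
  have rn: "norm (r k) \<le> norm x * (1/2) ^ k" for k
  proof (induction k)
    case (Suc k)
    have "norm (r (Suc k)) \<le> norm (r k) / 2"
      using fg(4)[OF rV] by (simp add: rS)
    with Suc show ?case by simp
  qed (simp add: r0)
  have fn: "norm (f (r k)) \<le> K * norm x * (1/2) ^ k" for k
  proof -
    have "norm (f (r k)) \<le> K * norm (r k)"
      using fg(3)[OF rV] .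
    also have "\<dots> \<le> K * (norm x * (1/2) ^ k)"
      using rn K by (rule mult_left_mono)
    finally show ?thesis by (simp add: mult.assoc)
  qed
  have geo: "(\<lambda>k. K * norm x * (1/2) ^ k) sums (K * norm x * 2)"
    using sums_mult[OF geometric_sums[of "1/2::real"]] by simp
  have sf: "summable (\<lambda>k. f (r k))"
    by (rule summable_comparison_test'[OF sums_summable[OF geo]]) (rule fn)
  define m where "m = (\<Sum>k. f (r k))"
  have mlim: "(\<lambda>n. \<Sum>k<n. f (r k)) \<longlonglongrightarrow> m"
    using summable_LIMSEQ[OF sf] by (simp add: m_def)
  have "m \<in> M"
    using M(1) _ mlim
    by (rule closed_sequentially) (intro subspace_sum M fg(1) rV)
  have "norm m \<le> K * norm x * 2"
    unfolding m_def sums_unique[OF geo]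
    by (rule norm_suminf_le[OF fn sums_summable[OF geo]])
  have tele: "(\<Sum>k<n. g (r k)) = x - r n - (\<Sum>k<n. f (r k))" for n
    by (induction n) (auto simp: r0 rS)
  have "(\<lambda>k. norm x * (1/2) ^ k) \<longlonglongrightarrow> norm x * 0"
    by (intro tendsto_mult tendsto_const LIMSEQ_realpow_zero) auto
  then have "r \<longlonglongrightarrow> 0"
    using rn by (intro Lim_null_comparison[of r "\<lambda>k. norm x * (1/2) ^ k"]) auto
  then have "(\<lambda>n. \<Sum>k<n. g (r k)) \<longlonglongrightarrow> x - 0 - m"
    unfolding tele by (intro tendsto_diff tendsto_const mlim)
  with N(1) _ have "x - 0 - m \<in> N"
    by (rule closed_sequentially) (intro subspace_sum N fg(2) rV)
  then show ?thesis
    using \<open>m \<in> M\<close> \<open>norm m \<le> K * norm x * 2\<close>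
    by (intro bexI[of _ m] bexI[of _ "x - m"]) auto
qed

text \<open>
  Baire's theorem enters here. The point \<open>a\<close> around which the closure of \<open>D k\<close> contains a ball need
  not be \<open>0\<close>; this is harmless, since a short multiple of \<open>y\<close> is the difference of two points of that
  ball, and the approximants from \<open>D k\<close> can be subtracted.
\<close>

lemma approximate_splitting_if_closed:
  fixes M N :: "'a::banach set"
  assumes M: "subspace M" and N: "subspace N" and clo: "closed (M + N)"
  shows "\<exists>K>0. \<forall>y\<in>M + N.
    \<exists>m\<in>M. \<exists>n\<in>N. norm m \<le> K * norm y \<and> norm (y - (m + n)) \<le> norm y / 2"
proof -
  define S where "S = M + N"
  define D where "D k = {x. \<exists>m\<in>M. \<exists>n\<in>N. x = m + n \<and> norm m \<le> real k}" for k
  have S: "subspace S"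
    unfolding S_def using M N by (rule subspace_set_plus)
  have "D k \<subseteq> S" for k
    by (auto simp: D_def S_def set_plus_def)
  then have clS: "closure (D k) \<subseteq> S" for k
    using clo closure_minimal S_def by metis
  have "S \<subseteq> (\<Union>k. closure (D k))"
  proof
    fix x assume "x \<in> S"
    then obtain m n where "m \<in> M" "n \<in> N" "x = m + n"
      by (auto simp: S_def set_plus_def)
    moreover obtain k where "norm m \<le> real k"
      using real_arch_simple by blast
    ultimately have "x \<in> D k"
      by (auto simp: D_def)
    then show "x \<in> (\<Union>k. closure (D k))"
      using closure_subset by blast
  qed
  then have un: "(\<Union>k. closure (D k)) = topspace (top_of_set S)"
    using clS by auto
  have "\<exists>k. top_of_set S interior_of closure (D k) \<noteq> {}"
  proof (rule ccontr)
    assume "\<not> ?thesis"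
    moreover have "completely_metrizable_space (top_of_set S)"
      using clo unfolding S_def
      by (intro completely_metrizable_space_closedin completely_metrizable_space_euclidean) auto
    moreover have "closedin (top_of_set S) (closure (D k))" for k
      using clS by (intro closed_subset) auto
    ultimately have "top_of_set S interior_of (\<Union>k. closure (D k)) = {}"
      by (intro Baire_category_alt) auto
    then have "topspace (top_of_set S) = {}"
      by (simp only: un interior_of_topspace)
    then show False
      using subspace_0[OF S] by auto
  qed
  then obtain k a T where T: "openin (top_of_set S) T" "T \<subseteq> closure (D k)" "a \<in> T"
    by (auto simp: interior_of_def)
  then obtain e where "e > 0" and e: "\<And>z. z \<in> S \<Longrightarrow> dist z a < e \<Longrightarrow> z \<in> T" and "a \<in> S"
    unfolding openin_euclidean_subtopology_iff by blast
  \<comment> \<open>The summand \<open>1\<close> only keeps \<open>K\<close> positive when \<open>k = 0\<close>.\<close>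
  define K where "K = 4 * real k / e + 1"
  have "K > 0"
    using \<open>e > 0\<close> by (simp add: K_def add_nonneg_pos)
  moreover have "\<exists>m\<in>M. \<exists>n\<in>N. norm m \<le> K * norm y \<and> norm (y - (m + n)) \<le> norm y / 2"
    if "y \<in> S" for y
  proof (cases "y = 0")
    case True
    then show ?thesis
      using subspace_0[OF M] subspace_0[OF N] by force
  next
    case False
    then have ny: "norm y > 0" by simp
    \<comment> \<open>The vector \<open>t *\<^sub>R y\<close> has norm \<open>e / 2\<close>. Two approximation errors of \<open>e / 8\<close> amount to half of
      that, which becomes \<open>norm y / 2\<close> after division by \<open>t\<close>.\<close>
    define t where "t = e / (2 * norm y)"
    have "t > 0"
      using \<open>e > 0\<close> ny by (simp add: t_def)
    have "a + t *\<^sub>R y \<in> S"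
      using S \<open>a \<in> S\<close> \<open>y \<in> S\<close> by (simp add: subspace_add subspace_scale)
    moreover have "dist (a + t *\<^sub>R y) a < e"
      using \<open>e > 0\<close> ny by (simp add: dist_norm t_def)
    ultimately have "a + t *\<^sub>R y \<in> closure (D k)" "a \<in> closure (D k)"
      using e T by auto
    then obtain p q where pq: "p \<in> D k" "q \<in> D k" "dist p a < e/8" "dist q (a + t *\<^sub>R y) < e/8"
      using \<open>e > 0\<close> by (metis closure_approachable zero_less_divide_iff zero_less_numeral)
    obtain m n where mn: "m \<in> M" "n \<in> N" "p = m + n" "norm m \<le> real k"
      using pq(1) by (auto simp: D_def)
    obtain m' n' where mn': "m' \<in> M" "n' \<in> N" "q = m' + n'" "norm m' \<le> real k"
      using pq(2) by (auto simp: D_def)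
    note split = set_plus_diff_split[OF M N mn(3,1,2) mn'(3,1,2), of "1/t"]
    have "norm ((1/t) *\<^sub>R (m' - m)) \<le> K * norm y"
    proof -
      have "norm (m' - m) \<le> 2 * real k"
        using norm_triangle_ineq4[of m' m] mn(4) mn'(4) by linarith
      then have "norm ((1/t) *\<^sub>R (m' - m)) \<le> 2 * real k / t"
        using \<open>t > 0\<close> by (simp add: divide_right_mono)
      also have "\<dots> = 4 * real k / e * norm y"
        by (simp add: t_def)
      also have "\<dots> \<le> K * norm y"
        by (simp add: K_def distrib_right)
      finally show ?thesis .
    qed
    moreover have "norm (y - (1/t) *\<^sub>R (q - p)) \<le> norm y / 2"
    proof -
      define w where "w = (a + t *\<^sub>R y - q) - (a - p)"
      have "y - (1/t) *\<^sub>R (q - p) = (1/t) *\<^sub>R w"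
        using \<open>t > 0\<close> by (simp add: w_def algebra_simps)
      then have "norm (y - (1/t) *\<^sub>R (q - p)) = norm w / t"
        using \<open>t > 0\<close> by simp
      also have "norm w \<le> norm (a + t *\<^sub>R y - q) + norm (a - p)"
        unfolding w_def by (rule norm_triangle_ineq4)
      then have "norm w \<le> e/4"
        using pq(3,4) by (simp add: dist_norm norm_minus_commute)
      then have "norm w / t \<le> (e/4) / t"
        using \<open>t > 0\<close> by (intro divide_right_mono) auto
      also have "\<dots> = norm y / 2"
        using \<open>e > 0\<close> by (simp add: t_def)
      finally show ?thesis .
    qed
    ultimately show ?thesis
      using split by metis
  qed
  ultimately show ?thesis
    unfolding S_def by blast
qed

text \<open>
  For a closed sum the approximation holds on \<open>V = M + N\<close> itself. In the other direction, a nonzero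
  point \<open>y\<close> of \<open>V = closure (M + N)\<close> has some \<open>z \<in> M + N\<close> within \<open>norm y / 2\<close>; the splitting of \<open>z\<close>
  approximates \<open>y\<close>, and \<open>norm z \<le> 2 * norm y\<close> turns the constant \<open>K\<close> into \<open>2 * K\<close>.
\<close>

theorem closed_set_plus_iff_bounded_splitting:
  fixes M N :: "'a::banach set"
  assumes M: "closed M" "subspace M" and N: "closed N" "subspace N"
  shows "closed (M + N) \<longleftrightarrow>
    (\<exists>K>0. \<forall>x\<in>M + N. \<exists>m\<in>M. \<exists>n\<in>N. x = m + n \<and> norm m \<le> K * norm x)"
proof
  have S: "subspace (M + N)"
    using M(2) N(2) by (rule subspace_set_plus)
  {
    assume "closed (M + N)"
    then obtain K where K: "K > 0" "\<And>y. y \<in> M + N \<Longrightarrow>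
        \<exists>m\<in>M. \<exists>n\<in>N. norm m \<le> K * norm y \<and> norm (y - (m + n)) \<le> norm y / 2"
      using approximate_splitting_if_closed[OF M(2) N(2)] by blast
    have "\<exists>m\<in>M. \<exists>n\<in>N. x = m + n \<and> norm m \<le> 2 * K * norm x" if "x \<in> M + N" for x
      by (rule bounded_splitting_from_approximate[OF M N S order_refl])
        (use K that in auto)
    then show "\<exists>K>0. \<forall>x\<in>M + N. \<exists>m\<in>M. \<exists>n\<in>N. x = m + n \<and> norm m \<le> K * norm x"
      using K(1) by (intro exI[of _ "2 * K"] conjI ballI) simp_all
  next
    assume "\<exists>K>0. \<forall>x\<in>M + N. \<exists>m\<in>M. \<exists>n\<in>N. x = m + n \<and> norm m \<le> K * norm x"
    then obtain K where "K > 0" and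
      K: "\<And>x. x \<in> M + N \<Longrightarrow> \<exists>m\<in>M. \<exists>n\<in>N. x = m + n \<and> norm m \<le> K * norm x"
      by blast
    have approx: "\<exists>m\<in>M. \<exists>n\<in>N. norm m \<le> (2 * K) * norm y \<and> norm (y - (m + n)) \<le> norm y / 2"
      if y: "y \<in> closure (M + N)" for y
    proof (cases "y = 0")
      case True
      then show ?thesis
        using subspace_0[OF M(2)] subspace_0[OF N(2)] by force
    next
      case False
      then have "norm y / 2 > 0" by simp
      with y obtain z where z: "z \<in> M + N" "dist z y < norm y / 2"
        unfolding closure_approachable by blast
      from K[OF z(1)] obtain m n where mn: "m \<in> M" "n \<in> N" "z = m + n" "norm m \<le> K * norm z"
        by blast
      have "norm z \<le> 2 * norm y"
        using z(2) norm_triangle_sub[of z y] norm_ge_zero[of y] unfolding dist_norm by linarith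
      then have "K * norm z \<le> K * (2 * norm y)"
        using \<open>K > 0\<close> by (intro mult_left_mono) auto
      with mn(4) have "norm m \<le> 2 * K * norm y"
        by linarith
      moreover have "norm (y - (m + n)) \<le> norm y / 2"
        using z(2) mn(3) by (simp add: dist_norm norm_minus_commute)
      ultimately show ?thesis
        using mn by blast
    qed
    have "x \<in> M + N" if "x \<in> closure (M + N)" for x
    proof -
      have "\<exists>m\<in>M. \<exists>n\<in>N. x = m + n \<and> norm m \<le> 2 * (2 * K) * norm x"
        by (rule bounded_splitting_from_approximate[OF M N _ closure_subset])
          (use approx \<open>K > 0\<close> that subspace_closure[OF S] in auto)
      then show ?thesis
        by (blast intro: set_plus_intro)
    qed
    then have "closure (M + N) = M + N"
      using closure_subset by blast
    then show "closed (M + N)"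
      by (metis closed_closure)
  }
qed

section \<open>Openness of the addition map\<close>

text \<open>
  Translating to a point \<open>m + n\<close> of the image, a bounded splitting of the small difference
  \<open>x - (m + n)\<close> perturbs both components by little: the \<open>N\<close>-component of a splitting with constant
  \<open>K\<close> has norm at most \<open>(K + 1) * norm (x - (m + n))\<close>. Conversely, the image of the unit ball
  of \<open>M\<close> times all of \<open>N\<close> contains a ball about \<open>0\<close> in \<open>M + N\<close>, which scales to a bounded splitting.
\<close>

theorem open_map_plus_iff_bounded_splitting:
  fixes M N :: "'a::real_normed_vector set"
  assumes M: "subspace M" and N: "subspace N"
  shows "open_map (prod_topology (top_of_set M) (top_of_set N)) (top_of_set (M + N))
      (\<lambda>(m, n). m + n) \<longleftrightarrow>
    (\<exists>K>0. \<forall>x\<in>M + N. \<exists>m\<in>M. \<exists>n\<in>N. x = m + n \<and> norm m \<le> K * norm x)"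
    (is "open_map ?P ?S ?add \<longleftrightarrow> ?split")
proof
  have S: "subspace (M + N)"
    using M N by (rule subspace_set_plus)
  have 0: "0 \<in> M" "0 \<in> N"
    using M N by (auto simp: subspace_0)
  {
    assume op: "open_map ?P ?S ?add"
    \<comment> \<open>Restricting only the \<open>M\<close>-component suffices, because only \<open>norm m\<close> has to be bounded.\<close>
    have "openin (top_of_set M) (M \<inter> ball 0 1)"
      by (simp add: openin_open_Int)
    then have "openin ?P ((M \<inter> ball 0 1) \<times> N)"
      unfolding openin_prod_Times_iff using openin_subtopology_self by blast
    then have "openin ?S (?add ` ((M \<inter> ball 0 1) \<times> N))"
      using op by (simp add: open_map_def)
    moreover have "0 \<in> ?add ` ((M \<inter> ball 0 1) \<times> N)"
      using 0 by (intro image_eqI[of _ _ "(0, 0)"]) auto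
    ultimately obtain e where "e > 0" and
      e: "\<And>x. x \<in> M + N \<Longrightarrow> dist x 0 < e \<Longrightarrow> x \<in> ?add ` ((M \<inter> ball 0 1) \<times> N)"
      unfolding openin_euclidean_subtopology_iff by blast
    have "\<exists>m\<in>M. \<exists>n\<in>N. x = m + n \<and> norm m \<le> 2 / e * norm x" if x: "x \<in> M + N" for x
    proof (cases "x = 0")
      case True
      then show ?thesis using 0 by force
    next
      case False
      define t where "t = e / (2 * norm x)"
      have "t > 0"
        using False \<open>e > 0\<close> by (simp add: t_def)
      have "t *\<^sub>R x \<in> M + N" "dist (t *\<^sub>R x) 0 < e"
        using S x False \<open>e > 0\<close> by (simp_all add: subspace_scale t_def)
      then have "t *\<^sub>R x \<in> ?add ` ((M \<inter> ball 0 1) \<times> N)"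
        by (rule e)
      then obtain m n where mn: "m \<in> M" "n \<in> N" "norm m < 1" "t *\<^sub>R x = m + n"
        by (auto elim!: imageE)
      have "x = (1/t) *\<^sub>R (t *\<^sub>R x)"
        using \<open>t > 0\<close> by simp
      then have "x = (1/t) *\<^sub>R m + (1/t) *\<^sub>R n"
        unfolding mn(4) by (simp add: scaleR_right_distrib)
      moreover have "norm ((1/t) *\<^sub>R m) \<le> 2 / e * norm x"
      proof -
        have "norm ((1/t) *\<^sub>R m) \<le> 1 / t"
          using mn(3) \<open>t > 0\<close> by (simp add: divide_right_mono)
        also have "\<dots> = 2 / e * norm x"
          by (simp add: t_def)
        finally show ?thesis .
      qed
      ultimately show ?thesis
        using mn M N subspace_scale by blast
    qed
    then show ?split
      using \<open>e > 0\<close> by (intro exI[of _ "2 / e"]) auto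
  next
    assume ?split
    then obtain K where "K > 0" and
      K: "\<And>x. x \<in> M + N \<Longrightarrow> \<exists>m\<in>M. \<exists>n\<in>N. x = m + n \<and> norm m \<le> K * norm x"
      by blast
    show "open_map ?P ?S ?add"
      unfolding open_map_def
    proof (intro allI impI)
      fix U assume U: "openin ?P U"
      then have UMN: "U \<subseteq> M \<times> N"
        using openin_subset by fastforce
      have "\<exists>d>0. \<forall>x\<in>M + N. dist x (m + n) < d \<longrightarrow> x \<in> ?add ` U" if mn: "(m, n) \<in> U" for m n
      proof -
        obtain A B where AB: "openin (top_of_set M) A" "openin (top_of_set N) B"
          "m \<in> A" "n \<in> B" "A \<times> B \<subseteq> U"
          using U[unfolded openin_prod_topology_alt, rule_format, OF mn] by blast
        obtain a where a: "a > 0" "\<And>z. z \<in> M \<Longrightarrow> dist z m < a \<Longrightarrow> z \<in> A"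
          using AB(1,3) unfolding openin_euclidean_subtopology_iff by blast
        obtain b where b: "b > 0" "\<And>z. z \<in> N \<Longrightarrow> dist z n < b \<Longrightarrow> z \<in> B"
          using AB(2,4) unfolding openin_euclidean_subtopology_iff by blast
        have "m \<in> M" "n \<in> N"
          using UMN mn by auto
        \<comment> \<open>The components \<open>u\<close> and \<open>v\<close> of a difference of norm less than \<open>d\<close> have norms less than
          \<open>K * d\<close> and \<open>(K + 1) * d\<close>.\<close>
        define d where "d = min a b / (K + 1)"
        have "d > 0"
          using a b \<open>K > 0\<close> by (simp add: d_def)
        moreover have "x \<in> ?add ` U" if x: "x \<in> M + N" "dist x (m + n) < d" for x
        proof -
          have "x - (m + n) \<in> M + N"
            using S x(1) \<open>m \<in> M\<close> \<open>n \<in> N\<close> by (intro subspace_diff set_plus_intro)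
          from K[OF this] obtain u v where uv: "u \<in> M" "v \<in> N" "x - (m + n) = u + v"
            "norm u \<le> K * norm (x - (m + n))"
            by blast
          have "norm (x - (m + n)) * (K + 1) < min a b"
            using x(2) \<open>K > 0\<close> pos_less_divide_eq[of "K + 1" "norm (x - (m + n))" "min a b"]
            unfolding d_def dist_norm by linarith
          then have lt: "K * norm (x - (m + n)) + norm (x - (m + n)) < min a b"
            by (simp only: distrib_left mult.commute[of _ K] mult_1_right)
          have "norm v \<le> norm (x - (m + n)) + norm u"
            using norm_triangle_ineq4[of "x - (m + n)" u] uv(3) by simp
          then have "norm u < a" "norm v < b"
            using uv(4) lt norm_ge_zero[of "x - (m + n)"] by linarith+
          then have "m + u \<in> A" "n + v \<in> B"
            using uv \<open>m \<in> M\<close> \<open>n \<in> N\<close> M N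
            by (auto intro!: a b simp: subspace_add dist_norm)
          then have "(m + u, n + v) \<in> U"
            using AB by blast
          moreover have "x = ?add (m + u, n + v)"
            using uv(3) by (simp add: algebra_simps)
          ultimately show ?thesis
            by (rule rev_image_eqI)
        qed
        ultimately show ?thesis by blast
      qed
      then have "\<forall>z\<in>?add ` U. \<exists>d>0. \<forall>x\<in>M + N. dist x z < d \<longrightarrow> x \<in> ?add ` U"
        by (auto simp only: ball_simps split_paired_all prod.case)
      moreover have "?add ` U \<subseteq> M + N"
        using UMN by (auto intro: set_plus_intro)
      ultimately show "openin ?S (?add ` U)"
        unfolding openin_euclidean_subtopology_iff by blast
    qed
  }
qed

section \<open>Closedness in the quotient\<close>

text \<open>
  \<open>S + N = S\<close> says that \<open>S\<close> is the full preimage of its image in the quotient. Then avoiding \<open>S\<close>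
  within distance \<open>r\<close> of \<open>x\<close> is the same as avoiding its image within quotient distance \<open>r\<close> of the
  coset of \<open>x\<close>: the quotient map does not increase distances, and a coset at distance less than \<open>r\<close>
  has a representative at distance less than \<open>r\<close>.
\<close>

theorem closed_iff_closedin_quotient:
  fixes N S :: "'a::real_normed_vector set"
  assumes N: "subspace N" "closed N" and SN: "S + N = S"
  shows "closed S \<longleftrightarrow> closedin (quotient_topology N) ((\<lambda>x. x +o N) ` S)"
proof -
  interpret Q: Metric_space "quotient_space N" "quotient_dist N"
    using N by (rule Metric_space_quotient)
  have N0: "0 \<in> N"
    using N(1) by (rule subspace_0)
  then have ne: "N \<noteq> {}" by blast
  have dist_eq: "quotient_dist N (x +o N) (y +o N) = infdist (x - y) N" for x y
    by (simp add: quotient_dist_coset quotient_norm_infdist N(1))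
  have in_img: "y +o N \<in> (\<lambda>x. x +o N) ` S \<longleftrightarrow> y \<in> S" for y
  proof
    assume "y +o N \<in> (\<lambda>x. x +o N) ` S"
    then obtain s where s: "s \<in> S" "y +o N = s +o N"
      by blast
    have "y \<in> y +o N"
      using N0 by (force simp: elt_set_plus_def)
    then have "y \<in> s +o N"
      by (simp only: s(2))
    then have "y \<in> S + N"
      using s(1) by (auto simp: elt_set_plus_def set_plus_def)
    then show "y \<in> S"
      by (simp only: SN)
  qed blast
  have close_iff: "(\<exists>y\<in>S. infdist (x - y) N < r) \<longleftrightarrow> (\<exists>y\<in>S. dist x y < r)" for x r
  proof
    assume "\<exists>y\<in>S. infdist (x - y) N < r"
    then obtain y where y: "y \<in> S" "infdist (x - y) N < r"
      by blast
    then obtain n where n: "n \<in> N" "dist (x - y) n < r"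
      using cINF_less_iff[OF ne bdd_below_image_dist] by (auto simp: infdist_notempty[OF ne])
    have "y + n \<in> S"
      using y(1) n(1) SN by blast
    moreover have "dist x (y + n) < r"
      using n(2) by (simp add: dist_norm algebra_simps)
    ultimately show "\<exists>y\<in>S. dist x y < r" by blast
  next
    assume "\<exists>y\<in>S. dist x y < r"
    moreover have "infdist (x - y) N \<le> dist x y" for y
      using infdist_le[OF N0, of "x - y"] by (simp add: dist_norm)
    ultimately show "\<exists>y\<in>S. infdist (x - y) N < r"
      using le_less_trans by blast
  qed
  have "closedin (quotient_topology N) ((\<lambda>x. x +o N) ` S) \<longleftrightarrow>
      (\<forall>x. x \<notin> S \<longrightarrow> (\<exists>r>0. \<not> (\<exists>y\<in>S. infdist (x - y) N < r)))"
  proof -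
    have coset: "x +o N \<in> quotient_space N" for x
      by (simp add: quotient_space_def)
    have sub: "(\<lambda>x. x +o N) ` S \<subseteq> quotient_space N"
      by (auto simp: quotient_space_def)
    have disj: "disjnt ((\<lambda>x. x +o N) ` S) (Q.mball (x +o N) r) \<longleftrightarrow>
        \<not> (\<exists>y\<in>S. infdist (x - y) N < r)" for x r
    proof -
      have "y +o N \<in> Q.mball (x +o N) r \<longleftrightarrow> infdist (x - y) N < r" for y
        by (simp add: Q.in_mball dist_eq coset)
      then show ?thesis
        unfolding disjnt_iff by blast
    qed
    show ?thesis
      unfolding quotient_topology_def Q.closedin_metric disj[symmetric]
      using sub in_img by (auto simp: quotient_space_def)
  qed
  also have "\<dots> \<longleftrightarrow> (\<forall>x. x \<notin> S \<longrightarrow> (\<exists>r>0. \<not> (\<exists>y\<in>S. dist x y < r)))"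
    by (simp only: close_iff)
  also have "\<dots> \<longleftrightarrow> closed S"
    unfolding closed_def open_dist Ball_def Bex_def Compl_iff by (simp add: dist_commute) blast
  finally show ?thesis by simp
qed

section \<open>The four equivalent conditions\<close>

theorem theorem2p1:
  fixes scale :: "'k::real_normed_field \<Rightarrow> 'a::banach \<Rightarrow> 'a"
    and M N :: "'a set"
  assumes "banach_space_over scale"
    and "module.subspace scale M" and "closed M"
    and "module.subspace scale N" and "closed N"
  shows "(closed (M + N) \<longleftrightarrow>
            closedin (quotient_topology N) ((\<lambda>x. x +o N) ` (M + N)))
       \<and> (closed (M + N) \<longleftrightarrow>
            (\<exists>K>0. \<forall>x\<in>M + N. \<exists>m\<in>M. \<exists>n\<in>N. x = m + n \<and> norm m \<le> K * norm x))
       \<and> (closed (M + N) \<longleftrightarrow>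
            open_map (prod_topology (top_of_set M) (top_of_set N)) (top_of_set (M + N))
              (\<lambda>(m, n). m + n))"
proof -
  have M: "subspace M" and N: "subspace N"
    using assms banach_space_over.subspace_imp_real_subspace by blast+
  have "N + N = N"
  proof
    show "N + N \<subseteq> N"
      using N by (auto simp: set_plus_def subspace_add)
    show "N \<subseteq> N + N"
      using subspace_0[OF N] by (force simp: set_plus_def)
  qed
  then have "(M + N) + N = M + N"
    by (simp add: add.assoc)
  then show ?thesis
    using closed_iff_closedin_quotient[OF N \<open>closed N\<close>]
      closed_set_plus_iff_bounded_splitting[OF \<open>closed M\<close> M \<open>closed N\<close> N]
      open_map_plus_iff_bounded_splitting[OF M N]
    by simp
qed

end
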